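(* Let $\alpha\approx 0.278$ be the real solution of the equation $\alpha e^{1+\alpha}=1$. For an integer $d\ge 2$, let $$\eta_d=\frac{\alpha^{d-1}(d-1)^{d-1}}{d^d}.$$ Let $n$ be a positive integer and let $Z=(z_{i_1\ldots i_d})$ be a $d$-dimensional complex $n\times\cdots\times n$ array such that the sum of $|1-z_{i_1\ldots i_d}|$ over each slice of $Z$ does not exceed $\eta_d n^{d-1}$. Then $\operatorname{PER}Z\ne 0$.
   Context: The permanent of a $d$-dimensional $n\times\cdots\times n$ array (tensor) $Z=(z_{i_1\ldots i_d})$ of $n^d$ real or complex numbers is $$\operatorname{PER}Z=\sum_{\sigma_2,\dots,\sigma_d\in S_n}\ \prod_{i=1}^n z_{i\,\sigma_2(i)\ldots\sigma_d(i)},$$ where $S_n$ is the symmetric group of permutations of $\{1,\dots,n\}$. A slice of $Z$ is the array of $n^{d-1}$ entries of $Z$ obtained by fixing one of the indices $i_1,\dots,i_d$ to a particular value and letting the remaining $d-1$ indices vary arbitrarily over $\{1,\dots,n\}$; thus $Z$ has $nd$ slices. *)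

theory Defs
  imports "HOL-Analysis.Analysis" "HOL-Combinatorics.Permutations"
begin

text \<open>
  A \<open>d\<close>-dimensional \<open>n \<times> \<dots> \<times> n\<close> array is a function on lists: the entry with indices
  \<open>i\<^sub>1, \<dots>, i\<^sub>d\<close> is \<open>Z [i\<^sub>1, \<dots>, i\<^sub>d]\<close>. Only its values on \<open>array_indices d n\<close> matter.
\<close>

definition array_indices :: "nat \<Rightarrow> nat \<Rightarrow> nat list set" where
  "array_indices d n = {ix. length ix = d \<and> set ix \<subseteq> {1..n}}"

text \<open>
  A slice is represented by the set of its positions. Index values run over \<open>{1..n}\<close>, whereas
  the coordinate \<open>k\<close> that is fixed is counted from \<open>0\<close>, as usual for list access.
\<close>

definition slice :: "nat \<Rightarrow> nat \<Rightarrow> nat \<Rightarrow> nat \<Rightarrow> nat list set" where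
  "slice d n k j = {ix \<in> array_indices d n. ix ! k = j}"

text \<open>
  The list \<open>\<sigma>s\<close> is the tuple \<open>(\<sigma>\<^sub>2, \<dots>, \<sigma>\<^sub>d)\<close> of \<open>d - 1\<close> permutations.
\<close>

definition PER :: "nat \<Rightarrow> nat \<Rightarrow> (nat list \<Rightarrow> 'a::comm_ring_1) \<Rightarrow> 'a" where
  "PER d n Z =
    (\<Sum>\<sigma>s \<in> {\<sigma>s. length \<sigma>s = d - 1 \<and> set \<sigma>s \<subseteq> {\<sigma>. \<sigma> permutes {1..n}}}.
      \<Prod>i\<in>{1..n}. Z (i # map (\<lambda>\<sigma>. \<sigma> i) \<sigma>s))"

definition alpha :: real where
  "alpha = (THE x. x * exp (1 + x) = 1)"

lemma alpha_ex1: "\<exists>!x::real. x * exp (1 + x) = 1"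
proof -
  have "\<exists>x\<ge>0. x \<le> 1 \<and> x * exp (1 + x) = (1::real)"
    by (rule IVT') (auto intro!: continuous_intros)
  moreover have "x = y" if x: "x * exp (1 + x) = 1" and y: "y * exp (1 + y) = 1" for x y :: real
  proof -
    have less: False if "u < v" "u * exp (1 + u) = 1" "v * exp (1 + v) = 1" for u v :: real
    proof -
      have "0 < u * exp (1 + u)" using that(2) by simp
      then have "0 < u" by (simp add: zero_less_mult_iff)
      have "u * exp (1 + u) < v * exp (1 + v)"
        using \<open>0 < u\<close> \<open>u < v\<close> by (intro mult_strict_mono) auto
      with that show False by simp
    qed
    show ?thesis using less x y by (metis linorder_neqE)
  qed
  ultimately show ?thesis by blast
qed

lemma alpha_eq: "alpha * exp (1 + alpha) = 1"
  unfolding alpha_def by (rule theI') (rule alpha_ex1)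

definition eta :: "nat \<Rightarrow> real" where
  "eta d = alpha ^ (d - 1) * real (d - 1) ^ (d - 1) / real d ^ d"

end

theory Submission
  imports Defs "HOL-Computational_Algebra.Fundamental_Theorem_Algebra"
begin

text \<open>
  Write \<open>Z = 1 + w\<close> and expand. Call a set of array positions a matching if any two of them differ
  in every coordinate. A set of positions lies on a generalized diagonal iff it is a matching, and
  a matching of size \<open>k\<close> lies on exactly \<open>((n - k)!)\<^bsup>d-1\<^esup>\<close> diagonals. Hence
  (\<open>PER_matching_expansion\<close>)
  \<open>PER Z = \<Sum>\<^sub>M ((n - |M|)!)\<^bsup>d-1\<^esup> \<Prod>\<^bsub>e \<in> M\<^esub> w\<^sub>e\<close>, summed over all matchings \<open>M\<close>. After the
  normalization \<open>v = w / n\<^bsup>d-1\<^esup>\<close>, and with \<open>a\<^sub>k\<close> the \<open>v\<close>-weight of all matchings of size \<open>k\<close>,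
  this becomes \<open>n!\<^bsup>d-1\<^esup> \<Sum>\<^sub>k a\<^sub>k t\<^sub>k\<^bsup>d-1\<^esup>\<close> with \<open>t\<^sub>k = n\<^sup>k (n - k)! / n!\<close>.

  Two facts show that this is not zero. First, the polynomial \<open>\<Sum>\<^sub>k a\<^sub>k z\<^sup>k\<close> without the
  multipliers \<open>t\<^sub>k\<close> is the matching polynomial of a \<open>d\<close>-uniform hypergraph whose vertices are the
  slices. Such a sum of weights does not vanish as long as the absolute weight at each vertex is at
  most \<open>(d-1)\<^bsup>d-1\<^esup> / d\<^sup>d\<close> (\<open>matching_sum_ratio\<close>), so under the hypothesis the polynomial has no
  zero in the disc of radius \<open>\<alpha>\<^bsup>-(d-1)\<^esup>\<close>.

  Second, multiplying the coefficients by \<open>t\<^sub>k\<close> is the Schur-Szego composition with the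
  truncated exponential series \<open>\<Sum>\<^bsub>k\<le>n\<^esub> (n z)\<^sup>k / k!\<close>, because \<open>t\<^sub>k = (n\<^sup>k / k!) / (n choose k)\<close>. That
  polynomial has no zero in the disc of radius \<open>\<alpha>\<close> (\<open>truncated_exp_nonzero\<close>), and composition
  multiplies the radii of root-free discs (\<open>szego_composition\<close>, a form of Grace's theorem). So each
  of the \<open>d - 1\<close> multiplications shrinks the root-free disc at most by the factor \<open>\<alpha>\<close>, and after
  all of them the closed unit disc is still free of zeros. Evaluating at \<open>z = 1\<close> gives the claim.
\<close>

section \<open>Grace's theorem and the composition of polynomials\<close>

text \<open>
  Polynomials without zero at the origin are factored as \<open>c \<Prod> (1 + \<zeta>\<^sub>i z)\<close> rather than
  \<open>c \<Prod> (z - r\<^sub>i)\<close>: with \<open>\<zeta>\<^sub>i = 0\<close> standing for a root at infinity, the number of factors can be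
  padded to any bound on the degree.
\<close>

definition linear_product :: "complex list \<Rightarrow> complex poly" where
  "linear_product \<zeta>s = prod_list (map (\<lambda>\<zeta>. [:1, \<zeta>:]) \<zeta>s)"

lemma linear_product_simps [simp]:
  "linear_product [] = 1"
  "linear_product (\<zeta> # \<zeta>s) = [:1, \<zeta>:] * linear_product \<zeta>s"
  by (simp_all add: linear_product_def)

lemma degree_linear_product: "degree (linear_product \<zeta>s) \<le> length \<zeta>s"
proof (induction \<zeta>s)
  case (Cons \<zeta> \<zeta>s)
  have "degree (linear_product (\<zeta> # \<zeta>s)) \<le> degree [:1, \<zeta>:] + degree (linear_product \<zeta>s)"
    unfolding linear_product_simps by (rule degree_mult_le)
  also have "\<dots> \<le> length (\<zeta> # \<zeta>s)"
    using Cons by (simp split: if_splits)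
  finally show ?case .
qed simp

lemma poly_linear_product_eq_0_iff:
  "poly (linear_product \<zeta>s) z = 0 \<longleftrightarrow> (\<exists>\<zeta>\<in>set \<zeta>s. 1 + \<zeta> * z = 0)"
  by (induction \<zeta>s) (auto simp: mult.commute[of z] simp del: mult_pCons_left mult_pCons_right)

lemma poly_as_linear_product:
  assumes "degree p \<le> n" "poly p 0 \<noteq> 0"
  shows "\<exists>c \<zeta>s. c \<noteq> 0 \<and> length \<zeta>s = n \<and> p = smult c (linear_product \<zeta>s)"
  using assms
proof (induction n arbitrary: p)
  case 0
  then obtain c where "p = [:c:]"
    by (metis degree_eq_zeroE le_zero_eq)
  with 0 show ?case
    by (intro exI[of _ c] exI[of _ "[]"]) auto
next
  case (Suc n)
  show ?case
  proof (cases "degree p = 0")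
    case True
    then have "\<exists>c \<zeta>s. c \<noteq> 0 \<and> length \<zeta>s = n \<and> p = smult c (linear_product \<zeta>s)"
      using Suc by simp
    then obtain c \<zeta>s where "c \<noteq> 0" "length \<zeta>s = n" "p = smult c (linear_product \<zeta>s)"
      by blast
    then show ?thesis
      by (intro exI[of _ c] exI[of _ "0 # \<zeta>s"]) auto
  next
    case False
    then obtain r where r: "poly p r = 0"
      using fundamental_theorem_of_algebra constant_degree by metis
    with Suc.prems have "r \<noteq> 0" by auto
    obtain q where q: "p = [:- r, 1:] * q"
      using r by (auto simp: poly_eq_0_iff_dvd)
    have "q \<noteq> 0" using False q by auto
    then have "degree p = Suc (degree q)"
      by (subst q, subst degree_mult_eq) auto
    with Suc.prems q have "degree q \<le> n" "poly q 0 \<noteq> 0" by auto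
    from Suc.IH[OF this] obtain c \<zeta>s
      where c: "c \<noteq> 0" "length \<zeta>s = n" "q = smult c (linear_product \<zeta>s)" by blast
    have "[:- r, 1:] = smult (- r) [:1, - inverse r:]"
      using \<open>r \<noteq> 0\<close> by simp
    then have "p = smult (c * - r) (linear_product (- inverse r # \<zeta>s))"
      unfolding q c(3) linear_product_simps by (simp only: mult_smult_left mult_smult_right smult_smult)
    then show ?thesis
      using c(1,2) \<open>r \<noteq> 0\<close> by (intro exI[of _ "c * - r"] exI[of _ "- inverse r # \<zeta>s"]) auto
  qed
qed

lemma root_free_disc_factorization:
  assumes "degree p \<le> n" and nz: "\<And>z. norm z \<le> 1 \<Longrightarrow> poly p z \<noteq> 0"
  obtains c \<zeta>s where "c \<noteq> 0" "length \<zeta>s = n" "p = smult c (linear_product \<zeta>s)"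
    "\<And>\<zeta>. \<zeta> \<in> set \<zeta>s \<Longrightarrow> norm \<zeta> < 1"
proof -
  obtain c \<zeta>s where c: "c \<noteq> 0" "length \<zeta>s = n" "p = smult c (linear_product \<zeta>s)"
    using poly_as_linear_product[OF assms(1)] nz[of 0] by auto
  have "norm \<zeta> < 1" if "\<zeta> \<in> set \<zeta>s" for \<zeta>
  proof (rule ccontr)
    assume "\<not> norm \<zeta> < 1"
    then have "norm (- inverse \<zeta>) \<le> 1" and "\<zeta> \<noteq> 0"
      by (auto simp: norm_inverse inverse_le_1_iff)
    moreover from \<open>\<zeta> \<noteq> 0\<close> have "1 + \<zeta> * (- inverse \<zeta>) = 0" by simp
    then have "poly p (- inverse \<zeta>) = 0"
      using that by (auto simp: c(3) poly_linear_product_eq_0_iff)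
    ultimately show False using nz by blast
  qed
  with c that show ?thesis by blast
qed

lemma poly_pderiv_linear_product:
  assumes "\<And>\<zeta>. \<zeta> \<in> set \<zeta>s \<Longrightarrow> 1 + \<zeta> * z \<noteq> 0"
  shows "poly (pderiv (linear_product \<zeta>s)) z =
    poly (linear_product \<zeta>s) z * (\<Sum>\<zeta>\<leftarrow>\<zeta>s. \<zeta> / (1 + \<zeta> * z))"
  using assms
proof (induction \<zeta>s)
  case (Cons \<zeta> \<zeta>s)
  have "1 + \<zeta> * z \<noteq> 0" using Cons.prems by auto
  then show ?case
    using Cons by (simp add: pderiv_mult pderiv_pCons field_simps del: mult_pCons_left mult_pCons_right)
qed simp

text \<open>
  With \<open>w = 1 / (z - r)\<close>, the condition says \<open>norm r > 1\<close>, and \<open>w = 0\<close> corresponds to \<open>r = \<infinity>\<close>. So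
  the set is the image of the exterior of the unit disc under the inversion at \<open>z\<close>. Squaring turns
  the condition into \<open>(1 - |z|\<^sup>2) |w|\<^sup>2 + 2 Re (z w) < 1\<close>, whose left side is convex in \<open>w\<close>
  because \<open>|z| \<le> 1\<close>.
\<close>

lemma convex_inverse_image_of_exterior:
  fixes z :: complex
  assumes "norm z \<le> 1"
  shows "convex {w. norm w < norm (z * w - 1)}"
proof -
  define g where "g w = (1 - (norm z)\<^sup>2) * (norm w)\<^sup>2 + 2 * Re (z * w)" for w :: complex
  have iff: "norm w < norm (z * w - 1) \<longleftrightarrow> g w < 1" for w
  proof -
    have "norm w < norm (z * w - 1) \<longleftrightarrow> (norm w)\<^sup>2 < (norm (z * w - 1))\<^sup>2"
      by (meson norm_ge_zero power2_less_imp_less power_strict_mono zero_less_numeral)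
    also have "(norm (z * w - 1))\<^sup>2 = (norm z)\<^sup>2 * (norm w)\<^sup>2 - 2 * Re (z * w) + 1"
      unfolding cmod_power2 by (simp add: algebra_simps power2_eq_square)
    finally show ?thesis by (auto simp: g_def algebra_simps)
  qed
  have "g (u *\<^sub>R x + v *\<^sub>R y) < 1"
    if "g x < 1" "g y < 1" and uv: "u \<ge> 0" "v \<ge> 0" "u + v = 1" for x y u v
  proof -
    have v: "v = 1 - u" using uv by simp
    \<comment> \<open>The defect of convexity of the squared norm is itself a square.\<close>
    have *: "u * (norm x)\<^sup>2 + v * (norm y)\<^sup>2 - (norm (u *\<^sub>R x + v *\<^sub>R y))\<^sup>2 = u * v * (norm (x - y))\<^sup>2"
      unfolding cmod_power2 v by (simp add: algebra_simps power2_eq_square)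
    have "(norm (u *\<^sub>R x + v *\<^sub>R y))\<^sup>2 \<le> u * (norm x)\<^sup>2 + v * (norm y)\<^sup>2"
      using * uv by (smt (verit) mult_nonneg_nonneg zero_le_power2)
    moreover have "1 - (norm z)\<^sup>2 \<ge> 0"
      using assms by (simp add: power_le_one)
    ultimately have "(1 - (norm z)\<^sup>2) * (norm (u *\<^sub>R x + v *\<^sub>R y))\<^sup>2
        \<le> (1 - (norm z)\<^sup>2) * (u * (norm x)\<^sup>2 + v * (norm y)\<^sup>2)"
      by (rule mult_left_mono)
    then have "g (u *\<^sub>R x + v *\<^sub>R y) \<le> u * g x + v * g y"
      unfolding g_def by (simp add: algebra_simps)
    also have "\<dots> < 1"
      using convex_bound_lt[of "g x" 1 "g y" u v] that by simp
    finally show ?thesis .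
  qed
  then show ?thesis
    unfolding iff by (auto simp: convex_def)
qed

text \<open>
  The classical polar derivative \<open>n p - (z - \<zeta>) p'\<close> of \<open>p\<close> as a polynomial of formal degree \<open>n\<close>,
  divided by \<open>n\<close>. In terms of the symmetric multiaffine polarization of \<open>p\<close>, it substitutes \<open>\<zeta>\<close>
  for one of the \<open>n\<close> variables.
\<close>

definition polar_derivative :: "nat \<Rightarrow> complex \<Rightarrow> complex poly \<Rightarrow> complex poly" where
  "polar_derivative n \<zeta> p = p - smult (1 / of_nat n) ([:- \<zeta>, 1:] * pderiv p)"

lemma coeff_polar_derivative:
  "coeff (polar_derivative n \<zeta> p) k =
    (1 - of_nat k / of_nat n) * coeff p k + \<zeta> * of_nat (Suc k) / of_nat n * coeff p (Suc k)"
  by (cases k) (simp_all add: polar_derivative_def coeff_pderiv coeff_pCons algebra_simps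
      add_divide_distrib diff_divide_distrib del: of_nat_Suc)

lemma degree_polar_derivative:
  assumes "degree p \<le> Suc n"
  shows "degree (polar_derivative (Suc n) \<zeta> p) \<le> n"
proof (rule degree_le, intro allI impI)
  fix k assume "n < k"
  then have "coeff p (Suc k) = 0" "k = Suc n \<or> coeff p k = 0"
    using assms by (auto intro!: coeff_eq_0)
  then show "coeff (polar_derivative (Suc n) \<zeta> p) k = 0"
    by (auto simp: coeff_polar_derivative simp del: of_nat_Suc)
qed

text \<open>
  Laguerre's theorem. At \<open>z = \<zeta>\<close> the polar derivative agrees with \<open>p\<close>. At a zero
  \<open>z \<noteq> \<zeta>\<close> of the polar derivative, the average of the numbers
  \<open>1 / (z - r\<^sub>i)\<close> over the \<open>n\<close> roots (finite or not) equals \<open>1 / (z - \<zeta>)\<close>. But the average stays in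
  the convex image of the exterior of the disc, to which \<open>1 / (z - \<zeta>)\<close> does not belong.
\<close>

lemma polar_derivative_nonzero:
  assumes deg: "degree p \<le> n" and "n > 0" and nz: "\<And>z. norm z \<le> 1 \<Longrightarrow> poly p z \<noteq> 0"
    and "norm \<zeta> \<le> 1" and z: "norm z \<le> 1"
  shows "poly (polar_derivative n \<zeta> p) z \<noteq> 0"
proof
  assume eq0: "poly (polar_derivative n \<zeta> p) z = 0"
  obtain c \<zeta>s where c: "c \<noteq> 0" "length \<zeta>s = n" "p = smult c (linear_product \<zeta>s)"
    and small: "\<And>\<zeta>. \<zeta> \<in> set \<zeta>s \<Longrightarrow> norm \<zeta> < 1"
    using root_free_disc_factorization[OF deg nz] by blast
  have ne: "1 + a * z \<noteq> 0" if "a \<in> set \<zeta>s" for a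
    using nz[OF z] that by (auto simp: c(3) poly_linear_product_eq_0_iff)
  \<comment> \<open>These are the numbers \<open>1 / (z - r\<^sub>i)\<close> for the roots \<open>r\<^sub>i = - 1 / \<zeta>\<^sub>i\<close>, with value \<open>0\<close> for \<open>r\<^sub>i = \<infinity>\<close>.\<close>
  define w where "w i = \<zeta>s ! i / (1 + \<zeta>s ! i * z)" for i
  define W where "W = (\<Sum>i<n. (1 / real n) *\<^sub>R w i)"
  have "W \<in> {w. norm w < norm (z * w - 1)}"
    unfolding W_def
  proof (rule convex_sum)
    show "convex {w. norm w < norm (z * w - 1)}"
      using z by (rule convex_inverse_image_of_exterior)
    fix i assume "i \<in> {..<n}"
    then have i: "\<zeta>s ! i \<in> set \<zeta>s" using c by auto
    have "z * w i - 1 = - 1 / (1 + \<zeta>s ! i * z)"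
      using ne[OF i] unfolding w_def by (simp add: field_simps)
    then have "norm (z * w i - 1) = 1 / norm (1 + \<zeta>s ! i * z)"
      by (simp add: norm_divide)
    moreover have "norm (w i) = norm (\<zeta>s ! i) / norm (1 + \<zeta>s ! i * z)"
      by (simp add: w_def norm_divide)
    ultimately show "w i \<in> {w. norm w < norm (z * w - 1)}"
      using small[OF i] ne[OF i] by (simp add: divide_strict_right_mono)
  qed (use \<open>n > 0\<close> in auto)
  then have W: "norm W < norm (z * W - 1)" by simp
  have "(\<Sum>a\<leftarrow>\<zeta>s. a / (1 + a * z)) = of_nat n * W"
    using \<open>n > 0\<close> c(2)
    by (simp add: W_def w_def sum_list_sum_nth atLeast0LessThan scaleR_conv_of_real
        sum_distrib_left)
  then have "poly (pderiv p) z = poly p z * (of_nat n * W)"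
    using poly_pderiv_linear_product[of \<zeta>s z] ne by (simp add: c(3) pderiv_smult)
  then have "1 / of_nat n * ((z - \<zeta>) * poly (pderiv p) z) = poly p z * ((z - \<zeta>) * W)"
    using \<open>n > 0\<close> by simp
  moreover have "poly (polar_derivative n \<zeta> p) z =
      poly p z - 1 / of_nat n * ((z - \<zeta>) * poly (pderiv p) z)"
    by (simp add: polar_derivative_def algebra_simps diff_divide_distrib)
  ultimately have "poly p z * (1 - (z - \<zeta>) * W) = 0"
    using eq0 by (simp only: right_diff_distrib mult_1_right)
  then have "1 - (z - \<zeta>) * W = 0"
    using nz[OF z] by simp
  then have "z * W - 1 = \<zeta> * W"
    by (simp add: algebra_simps)
  then have "norm (z * W - 1) \<le> norm W"
    using \<open>norm \<zeta> \<le> 1\<close> by (simp add: norm_mult mult_left_le_one_le)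
  with W show False by simp
qed

text \<open>
  Splitting a linear factor off the second polynomial passes to the polar derivative of the first.
  This drives the induction in Grace's theorem: the formal degree drops by one, and the absence of
  zeros in the disc is inherited by Laguerre's theorem.
\<close>

lemma apolar_pairing_step:
  assumes "degree q \<le> n"
  shows "(\<Sum>k\<le>Suc n. coeff p k * coeff ([:1, \<zeta>:] * q) k / of_nat (Suc n choose k)) =
    (\<Sum>k\<le>n. coeff (polar_derivative (Suc n) \<zeta> p) k * coeff q k / of_nat (n choose k))"
proof -
  have q: "coeff q (Suc n) = 0"
    using assms by (intro coeff_eq_0) auto
  have split: "(\<Sum>k\<le>Suc n. coeff p k * coeff ([:1, \<zeta>:] * q) k / of_nat (Suc n choose k)) =
      (\<Sum>k\<le>Suc n. coeff p k * coeff q k / of_nat (Suc n choose k)) +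
      (\<Sum>k\<le>Suc n. coeff p k * coeff (pCons 0 (smult \<zeta> q)) k / of_nat (Suc n choose k))"
    unfolding sum.distrib[symmetric]
    by (intro sum.cong refl) (simp add: algebra_simps add_divide_distrib)
  have first: "(\<Sum>k\<le>Suc n. coeff p k * coeff q k / of_nat (Suc n choose k)) =
      (\<Sum>k\<le>n. (1 - of_nat k / of_nat (Suc n)) * coeff p k * coeff q k / of_nat (n choose k))"
  proof -
    have "coeff p k * coeff q k / of_nat (Suc n choose k) =
        (1 - of_nat k / of_nat (Suc n)) * coeff p k * coeff q k / of_nat (n choose k)"
      if "k \<le> n" for k
    proof -
      have "(Suc n - k) * (Suc n choose k) = Suc n * (n choose k)"
        using binomial_absorb_comp[of "Suc n" k] by simp
      then have "of_nat ((Suc n - k) * (Suc n choose k)) = (of_nat (Suc n * (n choose k)) :: complex)"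
        by (rule arg_cong)
      then have "(of_nat (Suc n) - of_nat k) * of_nat (Suc n choose k)
          = of_nat (Suc n) * (of_nat (n choose k) :: complex)"
        using that by (simp only: of_nat_mult of_nat_diff le_SucI)
      moreover have "(of_nat (n choose k) :: complex) \<noteq> 0" "(of_nat (Suc n choose k) :: complex) \<noteq> 0"
        "(of_nat (Suc n) :: complex) \<noteq> 0"
        using that unfolding of_nat_eq_0_iff by (auto simp: binomial_eq_0_iff)
      ultimately have "1 / of_nat (Suc n choose k) =
          (1 - of_nat k / of_nat (Suc n)) / (of_nat (n choose k) :: complex)"
        by (simp add: field_simps del: of_nat_Suc binomial_Suc_Suc)
      then show ?thesis
        by (metis (no_types, lifting) mult.commute mult.left_commute mult.right_neutral times_divide_eq_right)
    qed
    then show ?thesis using q by simp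
  qed
  have "coeff p (Suc k) * (\<zeta> * coeff q k) / of_nat (Suc n choose Suc k) =
      (\<zeta> * of_nat (Suc k) / of_nat (Suc n) * coeff p (Suc k)) * coeff q k / of_nat (n choose k)"
    if "k \<le> n" for k
  proof -
    have "of_nat (Suc k * (Suc n choose Suc k)) = (of_nat (Suc n * (n choose k)) :: complex)"
      by (simp only: Suc_times_binomial)
    then have "of_nat (Suc k) * of_nat (Suc n choose Suc k)
        = of_nat (Suc n) * (of_nat (n choose k) :: complex)"
      by (simp only: of_nat_mult)
    moreover have "(of_nat (n choose k) :: complex) \<noteq> 0" "(of_nat (Suc n choose Suc k) :: complex) \<noteq> 0"
        "(of_nat (Suc n) :: complex) \<noteq> 0"
        using that unfolding of_nat_eq_0_iff by (auto simp: binomial_eq_0_iff)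
    ultimately have "1 / of_nat (Suc n choose Suc k) =
        of_nat (Suc k) / of_nat (Suc n) / (of_nat (n choose k) :: complex)"
      by (simp add: field_simps del: of_nat_Suc binomial_Suc_Suc)
    then have "coeff p (Suc k) * (\<zeta> * coeff q k) * (1 / of_nat (Suc n choose Suc k)) =
        coeff p (Suc k) * (\<zeta> * coeff q k) * (of_nat (Suc k) / of_nat (Suc n) / of_nat (n choose k))"
      by (rule arg_cong)
    then show ?thesis
      by (simp add: mult_ac del: of_nat_Suc binomial_Suc_Suc)
  qed
  then have second: "(\<Sum>k\<le>Suc n. coeff p k * coeff (pCons 0 (smult \<zeta> q)) k / of_nat (Suc n choose k)) =
      (\<Sum>k\<le>n. (\<zeta> * of_nat (Suc k) / of_nat (Suc n) * coeff p (Suc k)) * coeff q k / of_nat (n choose k))"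
    unfolding sum.atMost_Suc_shift by (simp del: of_nat_Suc binomial_Suc_Suc)
  show ?thesis
    unfolding split first second sum.distrib[symmetric] coeff_polar_derivative
    by (intro sum.cong refl) (simp only: distrib_right add_divide_distrib)
qed

text \<open>
  The sum is the polarization of \<open>p\<close>, evaluated at the numbers \<open>\<zeta>\<^sub>i\<close>; the elementary symmetric
  functions of these are the coefficients of the linear product.
\<close>

lemma grace_apolarity:
  assumes "degree p \<le> length \<zeta>s" "\<And>z. norm z \<le> 1 \<Longrightarrow> poly p z \<noteq> 0"
    and "\<And>\<zeta>. \<zeta> \<in> set \<zeta>s \<Longrightarrow> norm \<zeta> \<le> 1"
  shows "(\<Sum>k\<le>length \<zeta>s. coeff p k * coeff (linear_product \<zeta>s) k / of_nat (length \<zeta>s choose k)) \<noteq> 0"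
  using assms
proof (induction \<zeta>s arbitrary: p)
  case Nil
  then show ?case using Nil(2)[of 0] by (simp add: poly_0_coeff_0)
next
  case (Cons \<zeta> \<zeta>s)
  let ?n = "length \<zeta>s"
  have "(\<Sum>k\<le>?n. coeff (polar_derivative (Suc ?n) \<zeta> p) k * coeff (linear_product \<zeta>s) k
      / of_nat (?n choose k)) \<noteq> 0"
  proof (rule Cons.IH)
    show "degree (polar_derivative (Suc ?n) \<zeta> p) \<le> ?n"
      using Cons.prems(1) by (intro degree_polar_derivative) simp
    show "poly (polar_derivative (Suc ?n) \<zeta> p) z \<noteq> 0" if "norm z \<le> 1" for z
      using Cons.prems that by (intro polar_derivative_nonzero) auto
  qed (use Cons.prems in auto)
  then show ?case
    unfolding length_Cons linear_product_simps
    by (subst apolar_pairing_step[OF degree_linear_product])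
qed

text \<open>
  Write \<open>z = x y\<close> with \<open>x\<close> and \<open>y\<close> in the two root-free discs and rescale the variables by \<open>x\<close> and
  \<open>y\<close>. Both polynomials then have no zeros in the unit disc, the second one factors into terms
  \<open>1 + \<zeta>\<^sub>i u\<close> with \<open>|\<zeta>\<^sub>i| < 1\<close>, and Grace's theorem applies to the first.
\<close>

theorem szego_composition:
  fixes a b :: "nat \<Rightarrow> complex"
  assumes "r \<ge> 0" "s \<ge> 0"
    and a: "\<And>z. norm z \<le> r \<Longrightarrow> (\<Sum>k\<le>n. a k * z ^ k) \<noteq> 0"
    and b: "\<And>z. norm z \<le> s \<Longrightarrow> (\<Sum>k\<le>n. b k * z ^ k) \<noteq> 0"
    and z: "norm z \<le> r * s"
  shows "(\<Sum>k\<le>n. a k * b k / of_nat (n choose k) * z ^ k) \<noteq> 0"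
proof -
  define P :: "(nat \<Rightarrow> complex) \<Rightarrow> complex \<Rightarrow> complex poly"
    where "P c x = (\<Sum>k\<le>n. monom (c k * x ^ k) k)" for c x
  have poly_P: "poly (P c x) u = (\<Sum>k\<le>n. c k * (x * u) ^ k)" for c x u
    by (simp add: P_def poly_sum poly_monom power_mult_distrib mult_ac)
  have coeff_P: "coeff (P c x) k = (if k \<le> n then c k * x ^ k else 0)" for c x k
    by (simp add: P_def coeff_sum)
  have degree_P: "degree (P c x) \<le> n" for c x
    by (rule degree_le) (simp add: coeff_P)
  obtain x y where xy: "z = x * y" "norm x \<le> r" "norm y \<le> s"
  proof (cases "r * s = 0")
    case True
    then have "norm z \<le> 0" using z by (simp only:)
    then have "z = 0" by simp
    then show ?thesis using that[of 0 0] assms by simp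
  next
    case False
    then have "norm (z / of_real s) \<le> r" "z = z / of_real s * of_real s"
      using z assms by (auto simp: norm_divide field_simps)
    then show ?thesis using that[of "z / of_real s" "of_real s"] assms by simp
  qed
  have scaled: "norm (x * u) \<le> t" if "norm x \<le> t" "norm u \<le> 1" for x u :: complex and t
    using mult_mono[OF that] that by (auto simp: norm_mult intro: order_trans[OF norm_ge_zero])
  have "poly (P b y) u \<noteq> 0" if "norm u \<le> 1" for u
    unfolding poly_P using b scaled xy(3) that by blast
  then obtain c \<zeta>s where c: "c \<noteq> 0" "length \<zeta>s = n" "P b y = smult c (linear_product \<zeta>s)"
    and small: "\<And>\<zeta>. \<zeta> \<in> set \<zeta>s \<Longrightarrow> norm \<zeta> < 1"
    using root_free_disc_factorization[OF degree_P] by blast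
  have "(\<Sum>k\<le>n. coeff (P a x) k * coeff (linear_product \<zeta>s) k / of_nat (n choose k)) \<noteq> 0"
    unfolding c(2)[symmetric]
  proof (rule grace_apolarity)
    show "degree (P a x) \<le> length \<zeta>s" using degree_P c(2) by simp
    show "poly (P a x) u \<noteq> 0" if "norm u \<le> 1" for u
      unfolding poly_P using a scaled xy(2) that by blast
  qed (use small less_imp_le in blast)
  moreover have "(\<Sum>k\<le>n. a k * b k / of_nat (n choose k) * z ^ k) =
      (\<Sum>k\<le>n. coeff (P a x) k * coeff (P b y) k / of_nat (n choose k))"
    by (intro sum.cong refl) (simp add: coeff_P xy(1) power_mult_distrib)
  moreover have "\<dots> = c * (\<Sum>k\<le>n. coeff (P a x) k * coeff (linear_product \<zeta>s) k / of_nat (n choose k))"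
    unfolding c(3) sum_distrib_left by (intro sum.cong refl) simp
  ultimately show ?thesis using c(1) by simp
qed

section \<open>Zeros of the truncated exponential series\<close>

lemma alpha_pos: "alpha > 0"
proof -
  have "0 < alpha * exp (1 + alpha)" by (simp add: alpha_eq)
  then show ?thesis by (simp add: zero_less_mult_iff)
qed

lemma alpha_less_1: "alpha < 1"
proof (rule ccontr)
  assume "\<not> alpha < 1"
  then have "1 * 1 < alpha * exp (1 + alpha)"
    by (intro mult_le_less_imp_less) auto
  then show False by (simp add: alpha_eq)
qed

text \<open>
  At a zero, \<open>exp (n z)\<close> equals the tail of its series, whose modulus is less than \<open>\<alpha>\<^sup>n e\<^sup>n\<close>, since
  \<open>|z|\<^sup>k \<le> \<alpha>\<^sup>n\<close> for \<open>k > n\<close>. On the other hand its modulus is at least \<open>exp (- n \<alpha>)\<close>. The equation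
  \<open>\<alpha> exp (1 + \<alpha>) = 1\<close> says exactly that these two bounds coincide, a contradiction.
\<close>

lemma truncated_exp_nonzero:
  fixes z :: complex
  assumes "n > 0" and z: "norm z \<le> alpha"
  shows "(\<Sum>k\<le>n. of_nat n ^ k / fact k * z ^ k) \<noteq> 0"
proof
  assume T0: "(\<Sum>k\<le>n. of_nat n ^ k / fact k * z ^ k) = 0"
  define f where "f k = of_nat n ^ k / fact k * z ^ k" for k
  define g where "g k = real n ^ k / fact k" for k
  have g: "g sums exp (real n)"
    unfolding g_def using exp_converges[of "real n"] by (simp add: scaleR_conv_of_real field_simps)
  have f: "f sums exp (of_nat n * z)"
    unfolding f_def using exp_converges[of "of_nat n * z"]
    by (simp add: scaleR_conv_of_real field_simps power_mult_distrib)
  have f_tail: "(\<lambda>k. f (k + Suc n)) sums exp (of_nat n * z)"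
    using sums_split_initial_segment[OF f, of "Suc n"] T0
    by (simp add: f_def lessThan_Suc_atMost)
  have g_tail: "(\<lambda>k. g (k + Suc n)) sums (exp (real n) - (\<Sum>k\<le>n. g k))"
    using sums_split_initial_segment[OF g, of "Suc n"] by (simp add: lessThan_Suc_atMost)
  have le: "norm (f (k + Suc n)) \<le> alpha ^ n * g (k + Suc n)" for k
  proof -
    have "norm z ^ (k + Suc n) \<le> alpha ^ (k + Suc n)"
      using z by (intro power_mono) auto
    also have "\<dots> \<le> alpha ^ n"
      using alpha_pos alpha_less_1 by (intro power_decreasing) auto
    finally have "norm z ^ (k + Suc n) * g (k + Suc n) \<le> alpha ^ n * g (k + Suc n)"
      by (rule mult_right_mono) (simp add: g_def)
    moreover have "norm (f m) = norm z ^ m * g m" for m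
      by (simp add: f_def g_def norm_mult norm_divide norm_power mult_ac)
    ultimately show ?thesis by simp
  qed
  have "norm (exp (of_nat n * z)) \<le> alpha ^ n * (exp (real n) - (\<Sum>k\<le>n. g k))"
    unfolding sums_unique[OF f_tail] sums_unique[OF sums_mult[OF g_tail]]
    by (rule norm_suminf_le[OF le sums_summable[OF sums_mult[OF g_tail]]])
  also have "\<dots> < alpha ^ n * exp (real n)"
  proof -
    have "g 0 \<le> (\<Sum>k\<le>n. g k)"
      by (rule member_le_sum) (auto simp: g_def)
    then have "0 < (\<Sum>k\<le>n. g k)" by (simp add: g_def)
    then show ?thesis using alpha_pos by simp
  qed
  finally have "exp (real n * Re z) < alpha ^ n * exp (real n)" by simp
  moreover have "exp (- real n * alpha) \<le> exp (real n * Re z)"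
    using z abs_Re_le_cmod[of z] mult_left_mono[of "- alpha" "Re z" "real n"] by simp
  moreover have "alpha ^ n * exp (real n) = exp (- real n * alpha)"
  proof -
    have "alpha * exp 1 = exp (- alpha)"
      using alpha_eq by (simp add: exp_add exp_minus field_simps)
    then have "(alpha * exp 1) ^ n = exp (- alpha) ^ n" by simp
    then show ?thesis
      by (simp add: power_mult_distrib mult_ac flip: exp_of_nat_mult)
  qed
  ultimately show False by simp
qed

text \<open>
  Each multiplication of the coefficients by \<open>n\<^sup>k (n - k)! / n!\<close> is one composition with the truncated
  exponential series.
\<close>

lemma falling_factorial_multiplier_nonzero:
  fixes a :: "nat \<Rightarrow> complex"
  assumes "n > 0" "r \<ge> 0" and a: "\<And>z. norm z \<le> r \<Longrightarrow> (\<Sum>k\<le>n. a k * z ^ k) \<noteq> 0"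
    and "norm z \<le> r * alpha ^ m"
  shows "(\<Sum>k\<le>n. a k * (of_nat n ^ k * fact (n - k) / fact n) ^ m * z ^ k) \<noteq> 0"
  using assms(4)
proof (induction m arbitrary: z)
  case 0
  then show ?case using a by simp
next
  case (Suc m)
  let ?t = "\<lambda>k. of_nat n ^ k * fact (n - k) / fact n :: complex"
  have "(\<Sum>k\<le>n. (a k * ?t k ^ m) * (of_nat n ^ k / fact k) / of_nat (n choose k) * z ^ k) \<noteq> 0"
  proof (rule szego_composition)
    show "0 \<le> r * alpha ^ m" "0 \<le> alpha" using assms(2) alpha_pos by auto
    show "(\<Sum>k\<le>n. a k * ?t k ^ m * w ^ k) \<noteq> 0" if "norm w \<le> r * alpha ^ m" for w
      using Suc.IH[OF that] .
    show "norm z \<le> r * alpha ^ m * alpha" using Suc.prems by (simp add: mult_ac)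
  qed (use truncated_exp_nonzero[OF assms(1)] in blast)
  moreover have "(a k * ?t k ^ m) * (of_nat n ^ k / fact k) / of_nat (n choose k) * z ^ k =
      a k * ?t k ^ Suc m * z ^ k" if "k \<le> n" for k
  proof -
    have "(of_nat (n choose k) :: complex) = fact n / (fact k * fact (n - k))"
      using that by (rule binomial_fact)
    then show ?thesis by simp
  qed
  ultimately show ?case by simp
qed

section \<open>Weighted matchings in hypergraphs\<close>

text \<open>
  A hypergraph is given by a set of edge names, together with the map that sends an edge to its set
  of vertices.
\<close>

definition matchings :: "('e \<Rightarrow> 'v set) \<Rightarrow> 'e set \<Rightarrow> 'e set set" where
  "matchings f E = {M. M \<subseteq> E \<and> (\<forall>e\<in>M. \<forall>e'\<in>M. e \<noteq> e' \<longrightarrow> f e \<inter> f e' = {})}"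

definition matching_sum :: "('e \<Rightarrow> 'v set) \<Rightarrow> ('e \<Rightarrow> complex) \<Rightarrow> 'e set \<Rightarrow> complex" where
  "matching_sum f w E = (\<Sum>M\<in>matchings f E. \<Prod>e\<in>M. w e)"

definition avoiding :: "('e \<Rightarrow> 'v set) \<Rightarrow> 'e set \<Rightarrow> 'v set \<Rightarrow> 'e set" where
  "avoiding f E S = {e \<in> E. f e \<inter> S = {}}"

lemma finite_matchings: "finite E \<Longrightarrow> finite (matchings f E)"
  by (rule finite_subset[of _ "Pow E"]) (auto simp: matchings_def)

lemma matchings_subset: "M \<in> matchings f E \<Longrightarrow> N \<subseteq> M \<Longrightarrow> N \<in> matchings f E"
  by (simp add: matchings_def subset_eq)

lemma finite_avoiding: "finite E \<Longrightarrow> finite (avoiding f E S)"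
  by (simp add: avoiding_def)

lemma avoiding_insert: "avoiding f E (insert v S) = avoiding f (avoiding f E S) {v}"
  by (auto simp: avoiding_def)

text \<open>
  A matching either misses the vertex \<open>v\<close> or has exactly one edge through \<open>v\<close>; removing this edge
  leaves a matching of the edges disjoint from it.
\<close>

lemma matching_sum_recursion:
  assumes "finite E"
  shows "matching_sum f w E = matching_sum f w (avoiding f E {v}) +
    (\<Sum>e | e \<in> E \<and> v \<in> f e. w e * matching_sum f w (avoiding f E (f e)))"
proof -
  let ?E = "{e \<in> E. v \<in> f e}"
  let ?N = "\<lambda>e. insert e ` matchings f (avoiding f E (f e))"
  have "finite ?E" using assms by simp
  have fin: "finite (?N e)" for e
    by (intro finite_imageI finite_matchings finite_avoiding assms)
  have split: "matchings f E = matchings f (avoiding f E {v}) \<union> (\<Union>e\<in>?E. ?N e)" (is "_ = ?A \<union> ?B")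
  proof (intro equalityI subsetI)
    fix M assume M: "M \<in> matchings f E"
    show "M \<in> ?A \<union> ?B"
    proof (cases "\<exists>e\<in>M. v \<in> f e")
      case True
      then obtain e where e: "e \<in> M" "v \<in> f e" by blast
      have "M - {e} \<in> matchings f (avoiding f E (f e))"
        using M e(1) unfolding matchings_def avoiding_def by blast
      moreover have "M = insert e (M - {e})" using e by blast
      moreover have "e \<in> ?E" using M e by (auto simp: matchings_def)
      ultimately show ?thesis by blast
    next
      case False
      then show ?thesis using M by (auto simp: matchings_def avoiding_def)
    qed
  next
    fix M assume "M \<in> ?A \<union> ?B"
    then show "M \<in> matchings f E"
    proof
      assume "M \<in> ?B"
      then obtain e M' where "M = insert e M'" "e \<in> E" "M' \<in> matchings f (avoiding f E (f e))"
        by auto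
      then show ?thesis unfolding matchings_def avoiding_def by blast
    qed (auto simp: matchings_def avoiding_def)
  qed
  have disj: "?A \<inter> ?B = {}"
    by (auto simp: matchings_def avoiding_def)
  have disjN: "?N e \<inter> ?N e' = {}" if "e \<in> ?E" "e' \<in> ?E" "e \<noteq> e'" for e e'
  proof -
    have "e' \<notin> M" if "M \<in> ?N e" for M
      using that \<open>e \<in> ?E\<close> \<open>e' \<in> ?E\<close> \<open>e \<noteq> e'\<close> unfolding matchings_def avoiding_def by blast
    then show ?thesis by blast
  qed
  have inner: "(\<Sum>M\<in>?N e. \<Prod>e\<in>M. w e) = w e * matching_sum f w (avoiding f E (f e))"
    if "e \<in> ?E" for e
  proof -
    have notin: "e \<notin> M" "finite M" if "M \<in> matchings f (avoiding f E (f e))" for M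
      using that \<open>e \<in> ?E\<close> finite_subset[of M E] assms by (auto simp: matchings_def avoiding_def)
    then have "inj_on (insert e) (matchings f (avoiding f E (f e)))"
      by (intro inj_onI) (metis insert_ident)
    then have "(\<Sum>M\<in>?N e. \<Prod>e\<in>M. w e) =
        (\<Sum>M\<in>matchings f (avoiding f E (f e)). \<Prod>e\<in>insert e M. w e)"
      by (simp add: sum.reindex)
    also have "\<dots> = w e * matching_sum f w (avoiding f E (f e))"
      unfolding matching_sum_def sum_distrib_left using notin by (intro sum.cong) auto
    finally show ?thesis .
  qed
  have "matching_sum f w E = (\<Sum>M\<in>?A. \<Prod>e\<in>M. w e) + (\<Sum>M\<in>?B. \<Prod>e\<in>M. w e)"
    unfolding matching_sum_def split
    by (rule sum.union_disjoint) (use disj fin \<open>finite ?E\<close> assms in \<open>auto intro!: finite_matchings finite_avoiding\<close>)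
  also have "(\<Sum>M\<in>?B. \<Prod>e\<in>M. w e) = (\<Sum>e\<in>?E. \<Sum>M\<in>?N e. \<Prod>e\<in>M. w e)"
    by (rule sum.UNION_disjoint) (use fin \<open>finite ?E\<close> disjN in auto)
  also have "\<dots> = (\<Sum>e\<in>?E. w e * matching_sum f w (avoiding f E (f e)))"
    by (rule sum.cong[OF refl inner])
  finally show ?thesis by (simp only: matching_sum_def)
qed

text \<open>
  The bound on the effect of deleting a vertex is what makes the induction work. An edge \<open>e\<close>
  through \<open>v\<close> has \<open>d - 1\<close> further vertices, so deleting them after \<open>v\<close> increases the modulus of the sum
  by a factor of at most \<open>(d / (d-1))\<^bsup>d-1\<^esup>\<close>. By the recursion, deleting \<open>v\<close> changes the matching sum,
  relative to its value without \<open>v\<close>, by at most \<open>(d-1)\<^bsup>d-1\<^esup> / d\<^sup>d * (d / (d-1))\<^bsup>d-1\<^esup> = 1 / d\<close>, which is less than one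
  and restores the factor \<open>1 / (1 - 1/d) = d / (d-1)\<close>. This value is the optimal choice: \<open>x = 1/d\<close>
  maximizes the admissible weight \<open>x (1 - x)\<^bsup>d-1\<^esup>\<close>.
\<close>

lemma matching_sum_ratio:
  fixes w :: "'e \<Rightarrow> complex" and f :: "'e \<Rightarrow> 'v set"
  assumes "finite E" "d \<ge> 2" "\<And>e. e \<in> E \<Longrightarrow> card (f e) = d"
    and "\<And>v. (\<Sum>e | e \<in> E \<and> v \<in> f e. norm (w e)) \<le> real (d - 1) ^ (d - 1) / real d ^ d"
  shows "matching_sum f w E \<noteq> 0 \<and>
    (\<forall>v. norm (matching_sum f w (avoiding f E {v})) \<le> real d / real (d - 1) * norm (matching_sum f w E))"
  using assms(1,3,4)
proof (induction E rule: finite_psubset_induct)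
  case (psubset E)
  let ?Z = "matching_sum f w" and ?c = "real d / real (d - 1)"
  have c: "?c \<ge> 1" using \<open>d \<ge> 2\<close> by (simp add: field_simps)
  have IH: "?Z F \<noteq> 0 \<and> (\<forall>v. norm (?Z (avoiding f F {v})) \<le> ?c * norm (?Z F))" if "F \<subset> E" for F
  proof (rule psubset.IH[OF that])
    show "card (f e) = d" if "e \<in> F" for e
      using that \<open>F \<subset> E\<close> psubset.prems(1) by blast
    fix v
    have "(\<Sum>e | e \<in> F \<and> v \<in> f e. norm (w e)) \<le> (\<Sum>e | e \<in> E \<and> v \<in> f e. norm (w e))"
      by (rule sum_mono2) (use that psubset.hyps in auto)
    also have "\<dots> \<le> real (d - 1) ^ (d - 1) / real d ^ d" by (rule psubset.prems(2))
    finally show "(\<Sum>e | e \<in> F \<and> v \<in> f e. norm (w e)) \<le> real (d - 1) ^ (d - 1) / real d ^ d" .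
  qed
  \<comment> \<open>Deleting several vertices one after the other multiplies the bounds.\<close>
  have many: "norm (?Z (avoiding f F S)) \<le> ?c ^ card S * norm (?Z F)"
    if "F \<subset> E" "finite S" for F S
    using that(2)
  proof (induction S rule: finite_induct)
    case empty
    then show ?case by (simp add: avoiding_def)
  next
    case (insert v S)
    have "avoiding f F S \<subset> E" using \<open>F \<subset> E\<close> by (auto simp: avoiding_def)
    then have "norm (?Z (avoiding f F (insert v S))) \<le> ?c * norm (?Z (avoiding f F S))"
      unfolding avoiding_insert[of f F v S] using IH by blast
    also have "\<dots> \<le> ?c * (?c ^ card S * norm (?Z F))"
      using insert.IH c by (intro mult_left_mono) auto
    finally show ?case using insert.hyps by (simp add: mult_ac)
  qed
  have key: "?Z E \<noteq> 0 \<and> norm (?Z (avoiding f E {v})) \<le> ?c * norm (?Z E)"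
    if v: "avoiding f E {v} \<subset> E" for v
  proof -
    let ?F = "avoiding f E {v}"
    have summand: "norm (w e * ?Z (avoiding f E (f e))) \<le> norm (w e) * (?c ^ (d - 1) * norm (?Z ?F))"
      if e: "e \<in> E" "v \<in> f e" for e
    proof -
      have card: "card (f e) = d" using psubset.prems(1) e by blast
      then have "finite (f e)" using \<open>d \<ge> 2\<close> card.infinite by fastforce
      then have "norm (?Z (avoiding f ?F (f e - {v}))) \<le> ?c ^ card (f e - {v}) * norm (?Z ?F)"
        by (intro many v) simp
      moreover have "avoiding f ?F (f e - {v}) = avoiding f E (f e)"
        using e by (auto simp: avoiding_def)
      moreover have "card (f e - {v}) = d - 1" using e card by simp
      ultimately show ?thesis by (simp add: norm_mult mult_left_mono)
    qed
    have "norm (?Z E - ?Z ?F) \<le> (\<Sum>e | e \<in> E \<and> v \<in> f e. norm (w e) * (?c ^ (d - 1) * norm (?Z ?F)))"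
      using matching_sum_recursion[OF psubset.hyps(1), of f w v] summand
      by (auto intro!: sum_norm_le)
    also have "\<dots> = (\<Sum>e | e \<in> E \<and> v \<in> f e. norm (w e)) * (?c ^ (d - 1) * norm (?Z ?F))"
      by (simp add: sum_distrib_right)
    also have "\<dots> \<le> real (d - 1) ^ (d - 1) / real d ^ d * (?c ^ (d - 1) * norm (?Z ?F))"
      using c by (intro mult_right_mono psubset.prems(2)) auto
    also have "\<dots> = norm (?Z ?F) / real d"
    proof -
      have "real d ^ d = real d * real d ^ (d - 1)"
        using \<open>d \<ge> 2\<close> by (metis One_nat_def Suc_diff_le Suc_pred bot_nat_0.not_eq_extremum diff_Suc_1 not_numeral_le_zero power_Suc)
      moreover have "real (d - 1) \<noteq> 0" "real d \<noteq> 0" using \<open>d \<ge> 2\<close> by auto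
      ultimately show ?thesis by (simp add: power_divide)
    qed
    finally have "norm (?Z E - ?Z ?F) \<le> norm (?Z ?F) / real d" .
    moreover have "norm (?Z ?F) \<le> norm (?Z E) + norm (?Z E - ?Z ?F)"
      by (metis norm_minus_commute norm_triangle_sub)
    ultimately have *: "norm (?Z ?F) \<le> norm (?Z E) + norm (?Z ?F) / real d" by simp
    then have "norm (?Z ?F) * real (d - 1) \<le> norm (?Z E) * real d"
      using \<open>d \<ge> 2\<close> by (simp add: field_simps of_nat_diff)
    then have ratio: "norm (?Z ?F) \<le> ?c * norm (?Z E)"
      using \<open>d \<ge> 2\<close> by (simp add: field_simps)
    moreover have "?Z ?F \<noteq> 0" using IH v by blast
    ultimately have "?Z E \<noteq> 0" by auto
    with ratio show ?thesis by blast
  qed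
  have "?Z E \<noteq> 0"
  proof (cases "E = {}")
    case True
    have "matchings f {} = {{}}" by (auto simp: matchings_def)
    then show ?thesis using True by (simp add: matching_sum_def)
  next
    case False
    then obtain e where "e \<in> E" by blast
    moreover have "f e \<noteq> {}" using psubset.prems(1)[OF \<open>e \<in> E\<close>] \<open>d \<ge> 2\<close> by auto
    then obtain v where "v \<in> f e" by blast
    ultimately have "avoiding f E {v} \<subset> E" by (auto simp: avoiding_def)
    then show ?thesis using key by blast
  qed
  moreover have "norm (?Z (avoiding f E {v})) \<le> ?c * norm (?Z E)" for v
  proof (cases "avoiding f E {v} = E")
    case True
    then show ?thesis using mult_right_mono[OF c, of "norm (?Z E)"] by simp
  next
    case False
    then have "avoiding f E {v} \<subset> E" by (auto simp: avoiding_def)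
    then show ?thesis using key by blast
  qed
  ultimately show ?case by blast
qed

section \<open>Counting permutations and lists\<close>

text \<open>
  Composition with one extension \<open>\<tau>\<close> of \<open>f\<close> identifies all extensions with the permutations of
  \<open>A - S\<close>.
\<close>

lemma card_permutations_extending:
  assumes A: "finite A" and S: "S \<subseteq> A" and f: "inj_on f S" "f ` S \<subseteq> A"
  shows "card {\<sigma>. \<sigma> permutes A \<and> (\<forall>x\<in>S. \<sigma> x = f x)} = fact (card A - card S)"
proof -
  have fin: "finite S" using A S by (rule finite_subset[rotated])
  have "card (A - S) = card (A - f ` S)"
    using fin S f by (simp add: card_Diff_subset card_image)
  then obtain h where h: "bij_betw h (A - S) (A - f ` S)"
    using A by (metis finite_Diff finite_same_card_bij)
  define \<tau> where "\<tau> x = (if x \<in> S then f x else if x \<in> A then h x else x)" for x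
  have "bij_betw \<tau> S (f ` S)"
    using f(1) by (subst bij_betw_cong[of _ _ f]) (auto simp: \<tau>_def bij_betw_def)
  moreover have "bij_betw \<tau> (A - S) (A - f ` S)"
    using h by (subst bij_betw_cong[of _ _ h]) (auto simp: \<tau>_def)
  ultimately have "bij_betw \<tau> (S \<union> (A - S)) (f ` S \<union> (A - f ` S))"
    by (rule bij_betw_combine) auto
  moreover have "S \<union> (A - S) = A" "f ` S \<union> (A - f ` S) = A" using S f by auto
  ultimately have \<tau>: "\<tau> permutes A"
    using S by (intro bij_imp_permutes) (auto simp: \<tau>_def)
  have \<tau>S: "\<tau> x = f x" if "x \<in> S" for x using that by (simp add: \<tau>_def)
  have "{\<sigma>. \<sigma> permutes A \<and> (\<forall>x\<in>S. \<sigma> x = f x)} = (\<lambda>\<pi>. \<tau> \<circ> \<pi>) ` {\<pi>. \<pi> permutes (A - S)}"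
  proof (intro equalityI subsetI)
    fix \<sigma> assume \<sigma>: "\<sigma> \<in> {\<sigma>. \<sigma> permutes A \<and> (\<forall>x\<in>S. \<sigma> x = f x)}"
    have "inv \<tau> \<circ> \<sigma> permutes A"
      using \<sigma> \<tau> by (auto intro: permutes_compose permutes_inv)
    moreover have "(inv \<tau> \<circ> \<sigma>) x = x" if "x \<in> S" for x
      using that \<sigma> \<tau>S[OF that] permutes_inverses(2)[OF \<tau>, of x] by simp
    ultimately have "inv \<tau> \<circ> \<sigma> permutes (A - S)"
      by (rule permutes_superset) blast
    moreover have "\<sigma> = \<tau> \<circ> (inv \<tau> \<circ> \<sigma>)"
      by (simp only: o_assoc permutes_inv_o(1)[OF \<tau>] id_o)
    ultimately show "\<sigma> \<in> (\<lambda>\<pi>. \<tau> \<circ> \<pi>) ` {\<pi>. \<pi> permutes (A - S)}" by blast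
  next
    fix \<sigma> assume "\<sigma> \<in> (\<lambda>\<pi>. \<tau> \<circ> \<pi>) ` {\<pi>. \<pi> permutes (A - S)}"
    then obtain \<pi> where \<pi>: "\<pi> permutes (A - S)" "\<sigma> = \<tau> \<circ> \<pi>" by blast
    then have "\<sigma> permutes A"
      using \<tau> permutes_subset[OF \<pi>(1), of A] by (auto intro: permutes_compose)
    moreover have "\<sigma> x = f x" if "x \<in> S" for x
      using that \<pi> permutes_not_in[OF \<pi>(1), of x] \<tau>S by simp
    ultimately show "\<sigma> \<in> {\<sigma>. \<sigma> permutes A \<and> (\<forall>x\<in>S. \<sigma> x = f x)}" by blast
  qed
  moreover have "inj_on (\<lambda>\<pi>. \<tau> \<circ> \<pi>) {\<pi>. \<pi> permutes (A - S)}"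
    by (intro inj_onI) (metis fun.inj_map_strong permutes_inj[OF \<tau>] injD)
  ultimately have "card {\<sigma>. \<sigma> permutes A \<and> (\<forall>x\<in>S. \<sigma> x = f x)} = card {\<pi>. \<pi> permutes (A - S)}"
    by (simp add: card_image)
  also have "\<dots> = fact (card A - card S)"
    using A S fin by (intro card_permutations) (auto simp: card_Diff_subset)
  finally show ?thesis .
qed

lemma card_lists_nth_in:
  "card {xs. length xs = m \<and> (\<forall>k<m. xs ! k \<in> B k)} = (\<Prod>k<m. card (B k))"
proof -
  let ?L = "{xs. length xs = m \<and> (\<forall>k<m. xs ! k \<in> B k)}"
  have "bij_betw (\<lambda>xs. restrict ((!) xs) {..<m}) ?L (PiE {..<m} B)"
  proof (rule bij_betw_byWitness[where f' = "\<lambda>g. map g [0..<m]"])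
    show "\<forall>xs\<in>?L. map (restrict ((!) xs) {..<m}) [0..<m] = xs"
      by (auto intro!: nth_equalityI)
    show "\<forall>g\<in>PiE {..<m} B. restrict ((!) (map g [0..<m])) {..<m} = g"
      by (auto intro!: extensionalityI[of _ "{..<m}"] simp: PiE_def)
    show "(\<lambda>xs. restrict ((!) xs) {..<m}) ` ?L \<subseteq> PiE {..<m} B"
      by (auto split: if_splits)
    show "(\<lambda>g. map g [0..<m]) ` PiE {..<m} B \<subseteq> ?L"
      using PiE_mem[of _ "{..<m}" B] by auto
  qed
  then show ?thesis
    by (simp add: bij_betw_same_card card_PiE)
qed

section \<open>Expansion of the permanent into matchings\<close>

text \<open>
  The vertices of the array hypergraph are the slices, named by pairs of a coordinate and its value.
  A position is the edge consisting of the \<open>d\<close> slices through it.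
\<close>

definition coordinates :: "nat list \<Rightarrow> (nat \<times> nat) set" where
  "coordinates ix = {(k, ix ! k) | k. k < length ix}"

lemma mem_coordinates_iff: "(k, j) \<in> coordinates ix \<longleftrightarrow> k < length ix \<and> ix ! k = j"
  by (auto simp: coordinates_def)

lemma card_coordinates: "card (coordinates ix) = length ix"
proof -
  have "coordinates ix = (\<lambda>k. (k, ix ! k)) ` {..<length ix}"
    by (auto simp: coordinates_def)
  then show ?thesis by (simp add: card_image inj_on_def)
qed

lemma finite_array_indices: "finite (array_indices d n)"
  using finite_lists_length_eq[of "{1..n}" d] by (simp add: array_indices_def conj_commute)

lemma array_index_range:
  assumes "ix \<in> array_indices d n" "k < d"
  shows "ix ! k \<in> {1..n}"
proof -
  have "ix ! k \<in> set ix" using assms by (simp add: array_indices_def)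
  then show ?thesis using assms unfolding array_indices_def by blast
qed

abbreviation array_matchings :: "nat \<Rightarrow> nat \<Rightarrow> nat list set set" where
  "array_matchings d n \<equiv> matchings coordinates (array_indices d n)"

lemma array_matching_nth_inj:
  assumes "M \<in> array_matchings d n" "k < d" "ix \<in> M" "iy \<in> M" "ix ! k = iy ! k"
  shows "ix = iy"
proof (rule ccontr)
  assume "ix \<noteq> iy"
  then have "coordinates ix \<inter> coordinates iy = {}"
    using assms unfolding matchings_def by blast
  moreover have "length ix = d" "length iy = d"
    using assms by (auto simp: matchings_def array_indices_def)
  then have "(k, ix ! k) \<in> coordinates ix \<inter> coordinates iy"
    using assms by (auto simp: mem_coordinates_iff)
  ultimately show False by blast
qed

abbreviation permutation_tuples :: "nat \<Rightarrow> nat \<Rightarrow> (nat \<Rightarrow> nat) list set" where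
  "permutation_tuples d n \<equiv> {\<sigma>s. length \<sigma>s = d - 1 \<and> set \<sigma>s \<subseteq> {\<sigma>. \<sigma> permutes {1..n}}}"

lemma finite_permutation_tuples: "finite (permutation_tuples d n)"
proof -
  have "permutation_tuples d n =
      {\<sigma>s. set \<sigma>s \<subseteq> {\<sigma>. \<sigma> permutes {1..n}} \<and> length \<sigma>s = d - 1}"
    by (rule Collect_cong) (rule conj_commute)
  then show ?thesis
    by (simp only: finite_lists_length_eq finite_permutations finite_atLeastAtMost)
qed

definition diagonal :: "nat \<Rightarrow> (nat \<Rightarrow> nat) list \<Rightarrow> nat list set" where
  "diagonal n \<sigma>s = (\<lambda>i. i # map (\<lambda>\<sigma>. \<sigma> i) \<sigma>s) ` {1..n}"

lemma diagonal_matching: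
  assumes "d \<ge> 1" "\<sigma>s \<in> permutation_tuples d n"
  shows "diagonal n \<sigma>s \<in> array_matchings d n"
proof -
  have perm: "\<sigma>s ! k permutes {1..n}" if "k < length \<sigma>s" for k
    using nth_mem[OF that] assms(2) by blast
  have "diagonal n \<sigma>s \<subseteq> array_indices d n"
  proof
    fix ix assume "ix \<in> diagonal n \<sigma>s"
    then obtain i where i: "i \<in> {1..n}" "ix = i # map (\<lambda>\<sigma>. \<sigma> i) \<sigma>s"
      by (auto simp: diagonal_def)
    moreover have "\<sigma> i \<in> {1..n}" if "\<sigma> \<in> set \<sigma>s" for \<sigma>
      using that assms i(1) permutes_in_image[of \<sigma> "{1..n}" i] by auto
    ultimately show "ix \<in> array_indices d n"
      using assms by (auto simp: array_indices_def)
  qed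
  moreover have "i = j"
    if "(k, a) \<in> coordinates (i # map (\<lambda>\<sigma>. \<sigma> i) \<sigma>s)" "(k, a) \<in> coordinates (j # map (\<lambda>\<sigma>. \<sigma> j) \<sigma>s)"
    for i j k a
  proof (cases k)
    case 0
    then show ?thesis using that by (simp add: mem_coordinates_iff)
  next
    case (Suc l)
    then have "l < length \<sigma>s" "(\<sigma>s ! l) i = (\<sigma>s ! l) j"
      using that by (auto simp: mem_coordinates_iff)
    then show ?thesis using permutes_inj[OF perm] by (auto dest: injD)
  qed
  then have "coordinates ix \<inter> coordinates iy = {}"
    if "ix \<in> diagonal n \<sigma>s" "iy \<in> diagonal n \<sigma>s" "ix \<noteq> iy" for ix iy
    using that unfolding diagonal_def by (auto simp: image_iff)
  ultimately show ?thesis unfolding matchings_def by blast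
qed

lemma subset_diagonal_iff:
  assumes "d \<ge> 1" "length \<sigma>s = d - 1" "M \<subseteq> array_indices d n"
  shows "M \<subseteq> diagonal n \<sigma>s \<longleftrightarrow> (\<forall>ix\<in>M. \<forall>k<d - 1. (\<sigma>s ! k) (ix ! 0) = ix ! Suc k)"
proof -
  have "ix \<in> diagonal n \<sigma>s \<longleftrightarrow> (\<forall>k<d - 1. (\<sigma>s ! k) (ix ! 0) = ix ! Suc k)" if "ix \<in> M" for ix
  proof -
    have "length ix = d" "set ix \<subseteq> {1..n}"
      using that assms by (auto simp: array_indices_def)
    then obtain i xs where ix: "ix = i # xs" "i \<in> {1..n}" "length xs = d - 1"
      using \<open>d \<ge> 1\<close> by (cases ix) auto
    then have "ix \<in> diagonal n \<sigma>s \<longleftrightarrow> xs = map (\<lambda>\<sigma>. \<sigma> i) \<sigma>s"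
      by (auto simp: diagonal_def)
    also have "\<dots> \<longleftrightarrow> (\<forall>k<d - 1. (\<sigma>s ! k) i = xs ! k)"
      using ix assms(2) by (auto simp: list_eq_iff_nth_eq)
    finally show ?thesis by (simp add: ix)
  qed
  then show ?thesis by blast
qed

lemma card_array_matching_le:
  assumes "d \<ge> 1" "M \<in> array_matchings d n"
  shows "card M \<le> n" "finite M"
proof -
  have M: "M \<subseteq> array_indices d n" using assms by (simp add: matchings_def)
  then show "finite M" using finite_array_indices by (rule finite_subset)
  have "inj_on (\<lambda>ix. ix ! 0) M"
    using array_matching_nth_inj[OF assms(2), of 0] assms(1) by (auto intro: inj_onI)
  moreover have "(\<lambda>ix. ix ! 0) ` M \<subseteq> {1..n}"
    using M assms(1) by (intro image_subsetI array_index_range[where d = d]) auto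
  ultimately show "card M \<le> n"
    using card_inj_on_le[of "\<lambda>ix. ix ! 0" M "{1..n}"] by simp
qed

text \<open>
  Containing \<open>M\<close> prescribes each of the \<open>d - 1\<close> permutations on the set of first coordinates of \<open>M\<close>.
  These prescriptions are injective since \<open>M\<close> is a matching, and the permutations can be chosen
  independently of each other.
\<close>

lemma card_diagonals_containing:
  assumes "d \<ge> 1" "M \<in> array_matchings d n"
  shows "card {\<sigma>s \<in> permutation_tuples d n. M \<subseteq> diagonal n \<sigma>s} = fact (n - card M) ^ (d - 1)"
proof -
  have M: "M \<subseteq> array_indices d n" using assms by (simp add: matchings_def)
  have nth: "ix ! k \<in> {1..n}" if "ix \<in> M" "k < d" for ix k
    using subsetD[OF M \<open>ix \<in> M\<close>] \<open>k < d\<close> by (rule array_index_range)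
  define B where "B k = {\<sigma>. \<sigma> permutes {1..n} \<and> (\<forall>ix\<in>M. \<sigma> (ix ! 0) = ix ! Suc k)}" for k
  have "{\<sigma>s \<in> permutation_tuples d n. M \<subseteq> diagonal n \<sigma>s} =
      {\<sigma>s. length \<sigma>s = d - 1 \<and> (\<forall>k<d - 1. \<sigma>s ! k \<in> B k)}" (is "?L = ?R")
  proof -
    have "\<sigma>s \<in> ?L \<longleftrightarrow> \<sigma>s \<in> ?R" for \<sigma>s
    proof (cases "length \<sigma>s = d - 1")
      case True
      then have "set \<sigma>s \<subseteq> {\<sigma>. \<sigma> permutes {1..n}} \<longleftrightarrow> (\<forall>k<d - 1. \<sigma>s ! k permutes {1..n})"
        by (auto simp: set_conv_nth)
      then show ?thesis
        using subset_diagonal_iff[OF assms(1) True M] True by (auto simp: B_def)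
    qed simp
    then show ?thesis by blast
  qed
  then have "card ?L = (\<Prod>k<d - 1. card (B k))"
    by (simp only: card_lists_nth_in)
  also have "\<dots> = (\<Prod>k<d - 1. fact (n - card M))"
  proof (intro prod.cong refl)
    fix k assume "k \<in> {..<d - 1}"
    then have k: "0 < d" "Suc k < d" using assms(1) by auto
    let ?S = "(\<lambda>ix. ix ! 0) ` M"
    \<comment> \<open>The first coordinate determines the position in \<open>M\<close>, hence also its other coordinates.\<close>
    define f where "f i = (THE ix. ix \<in> M \<and> ix ! 0 = i) ! Suc k" for i
    have f: "f (ix ! 0) = ix ! Suc k" if "ix \<in> M" for ix
    proof -
      have "(THE iy. iy \<in> M \<and> iy ! 0 = ix ! 0) = ix"
        by (rule the_equality) (use that array_matching_nth_inj[OF assms(2) k(1)] in auto)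
      then show ?thesis by (simp add: f_def)
    qed
    have "B k = {\<sigma>. \<sigma> permutes {1..n} \<and> (\<forall>x\<in>?S. \<sigma> x = f x)}"
      using f by (auto simp: B_def)
    also have "card \<dots> = fact (card {1..n} - card ?S)"
    proof (rule card_permutations_extending)
      show "inj_on f ?S"
        using f array_matching_nth_inj[OF assms(2) k(2)] by (auto simp: inj_on_def)
    qed (use nth k f in auto)
    also have "card ?S = card M"
      using array_matching_nth_inj[OF assms(2) k(1)] by (intro card_image inj_onI) auto
    finally show "card (B k) = fact (n - card M)" by simp
  qed
  finally show ?thesis by simp
qed

text \<open>
  Expand every product over a diagonal into a sum over subsets of the diagonal, all of which are
  matchings, and exchange the two summations.
\<close>

lemma PER_matching_expansion:
  fixes w :: "nat list \<Rightarrow> 'a::{comm_ring_1, semiring_char_0}"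
  assumes "d \<ge> 1"
  shows "PER d n (\<lambda>ix. 1 + w ix) =
    (\<Sum>M\<in>array_matchings d n. fact (n - card M) ^ (d - 1) * (\<Prod>ix\<in>M. w ix))"
proof -
  have row: "(\<Prod>i\<in>{1..n}. 1 + w (i # map (\<lambda>\<sigma>. \<sigma> i) \<sigma>s)) =
      (\<Sum>M | M \<in> array_matchings d n \<and> M \<subseteq> diagonal n \<sigma>s. \<Prod>ix\<in>M. w ix)"
    if "\<sigma>s \<in> permutation_tuples d n" for \<sigma>s
  proof -
    have "(\<Prod>i\<in>{1..n}. 1 + w (i # map (\<lambda>\<sigma>. \<sigma> i) \<sigma>s)) = (\<Prod>ix\<in>diagonal n \<sigma>s. w ix + 1)"
      unfolding diagonal_def by (subst prod.reindex) (simp_all add: inj_on_def add.commute)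
    also have "\<dots> = (\<Sum>M\<in>Pow (diagonal n \<sigma>s). \<Prod>ix\<in>M. w ix)"
      by (subst prod_add) (auto simp: diagonal_def)
    also have "Pow (diagonal n \<sigma>s) = {M. M \<in> array_matchings d n \<and> M \<subseteq> diagonal n \<sigma>s}"
      using matchings_subset[OF diagonal_matching[OF assms that]] by auto
    finally show ?thesis .
  qed
  have "PER d n (\<lambda>ix. 1 + w ix) =
      (\<Sum>\<sigma>s\<in>permutation_tuples d n. \<Sum>M | M \<in> array_matchings d n \<and> M \<subseteq> diagonal n \<sigma>s. \<Prod>ix\<in>M. w ix)"
    unfolding PER_def by (rule sum.cong[OF refl row])
  also have "\<dots> = (\<Sum>M\<in>array_matchings d n.
      \<Sum>\<sigma>s | \<sigma>s \<in> permutation_tuples d n \<and> M \<subseteq> diagonal n \<sigma>s. \<Prod>ix\<in>M. w ix)"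
    by (rule sum.swap_restrict[OF finite_permutation_tuples finite_matchings[OF finite_array_indices]])
  also have "\<dots> = (\<Sum>M\<in>array_matchings d n. fact (n - card M) ^ (d - 1) * (\<Prod>ix\<in>M. w ix))"
    by (intro sum.cong refl)
       (simp only: sum_constant card_diagonals_containing[OF assms] of_nat_power of_nat_fact)
  finally show ?thesis .
qed

section \<open>Non-vanishing of the permanent\<close>

theorem theorem3p6:
  fixes d n :: nat and Z :: "nat list \<Rightarrow> complex"
  assumes "d \<ge> 2" and "n \<ge> 1"
    and "\<And>k j. k < d \<Longrightarrow> j \<in> {1..n} \<Longrightarrow>
      (\<Sum>ix\<in>slice d n k j. cmod (1 - Z ix)) \<le> eta d * real n ^ (d - 1)"
  shows "PER d n Z \<noteq> 0"
proof -
  define w where "w ix = Z ix - 1" for ix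
  define v where "v ix = w ix / of_nat n ^ (d - 1)" for ix
  define a where "a k = (\<Sum>M | M \<in> array_matchings d n \<and> card M = k. \<Prod>ix\<in>M. v ix)" for k
  \<comment> \<open>The matching polynomial is root-free on this disc, and \<open>d - 1\<close> compositions shrink it to the unit disc.\<close>
  define R where "R = 1 / alpha ^ (d - 1)"
  have R: "R > 0" "R * alpha ^ (d - 1) = 1" using alpha_pos by (auto simp: R_def)
  have fin: "finite (array_matchings d n)"
    by (intro finite_matchings finite_array_indices)
  have by_size: "(\<Sum>k\<le>n. a k * c k) = (\<Sum>M\<in>array_matchings d n. (\<Prod>ix\<in>M. v ix) * c (card M))"
    for c :: "nat \<Rightarrow> complex"
  proof -
    have "(\<Sum>k\<le>n. a k * c k) =
        (\<Sum>k\<le>n. \<Sum>M | M \<in> array_matchings d n \<and> card M = k. (\<Prod>ix\<in>M. v ix) * c (card M))"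
      unfolding a_def sum_distrib_right by (intro sum.cong refl) auto
    also have "\<dots> = (\<Sum>M\<in>array_matchings d n. (\<Prod>ix\<in>M. v ix) * c (card M))"
      using card_array_matching_le[of d _ n] \<open>d \<ge> 2\<close> by (intro sum.group fin) auto
    finally show ?thesis .
  qed
  have root_free: "(\<Sum>k\<le>n. a k * z ^ k) \<noteq> 0" if z: "norm z \<le> R" for z
  proof -
    \<comment> \<open>Scaling all weights by \<open>z\<close> turns the polynomial into a matching sum.\<close>
    have "(\<Sum>k\<le>n. a k * z ^ k) = matching_sum coordinates (\<lambda>ix. z * v ix) (array_indices d n)"
      unfolding by_size matching_sum_def by (simp add: prod.distrib mult.commute)
    moreover have "matching_sum coordinates (\<lambda>ix. z * v ix) (array_indices d n) \<noteq> 0"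
    proof (rule matching_sum_ratio[THEN conjunct1, OF finite_array_indices \<open>d \<ge> 2\<close>])
      show "card (coordinates ix) = d" if "ix \<in> array_indices d n" for ix
        using that by (simp add: card_coordinates array_indices_def)
      show "(\<Sum>ix | ix \<in> array_indices d n \<and> x \<in> coordinates ix. norm (z * v ix))
          \<le> real (d - 1) ^ (d - 1) / real d ^ d" for x
      proof (cases x)
        case (Pair k j)
        show ?thesis
        proof (cases "k < d \<and> j \<in> {1..n}")
          case True
          then have "{ix \<in> array_indices d n. x \<in> coordinates ix} = slice d n k j"
            by (auto simp: slice_def array_indices_def mem_coordinates_iff Pair)
          then have "(\<Sum>ix | ix \<in> array_indices d n \<and> x \<in> coordinates ix. norm (z * v ix))
              = norm z / real n ^ (d - 1) * (\<Sum>ix\<in>slice d n k j. cmod (1 - Z ix))"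
            by (simp add: v_def w_def norm_mult norm_divide norm_power norm_minus_commute
                sum_distrib_left)
          also have "\<dots> \<le> R / real n ^ (d - 1) * (eta d * real n ^ (d - 1))"
            using assms(3) True z \<open>R > 0\<close>
            by (intro mult_mono divide_right_mono) (auto intro!: sum_nonneg)
          also have "\<dots> = real (d - 1) ^ (d - 1) / real d ^ d"
            using \<open>n \<ge> 1\<close> alpha_pos by (simp add: R_def eta_def)
          finally show ?thesis .
        next
          case False
          have "{ix \<in> array_indices d n. x \<in> coordinates ix} = {}"
            using False nth_mem by (fastforce simp: array_indices_def mem_coordinates_iff Pair)
          then show ?thesis by (simp only: sum.empty) simp
        qed
      qed
    qed
    ultimately show ?thesis by simp
  qed
  have "(\<Sum>k\<le>n. a k * (of_nat n ^ k * fact (n - k) / fact n) ^ (d - 1) * 1 ^ k) \<noteq> 0"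
    by (rule falling_factorial_multiplier_nonzero[where r = R]) (use root_free assms R in auto)
  moreover have "PER d n Z = fact n ^ (d - 1) *
      (\<Sum>k\<le>n. a k * (of_nat n ^ k * fact (n - k) / fact n) ^ (d - 1) * 1 ^ k)"
  proof -
    have "PER d n Z = PER d n (\<lambda>ix. 1 + w ix)" by (simp add: w_def)
    also have "\<dots> = (\<Sum>M\<in>array_matchings d n. fact (n - card M) ^ (d - 1) * (\<Prod>ix\<in>M. w ix))"
      using \<open>d \<ge> 2\<close> by (intro PER_matching_expansion) simp
    also have "\<dots> = (\<Sum>M\<in>array_matchings d n. fact n ^ (d - 1) * ((\<Prod>ix\<in>M. v ix) *
        (of_nat n ^ card M * fact (n - card M) / fact n) ^ (d - 1)))"
    proof (intro sum.cong refl)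
      fix M
      have "(\<Prod>ix\<in>M. v ix) = (\<Prod>ix\<in>M. w ix) / (of_nat n ^ card M) ^ (d - 1)"
        by (simp add: v_def prod_dividef mult.commute flip: power_mult)
      then show "fact (n - card M) ^ (d - 1) * (\<Prod>ix\<in>M. w ix) = fact n ^ (d - 1) *
          ((\<Prod>ix\<in>M. v ix) * (of_nat n ^ card M * fact (n - card M) / fact n) ^ (d - 1))"
        using \<open>n \<ge> 1\<close> by (simp add: power_divide power_mult_distrib)
    qed
    also have "\<dots> = fact n ^ (d - 1) *
        (\<Sum>k\<le>n. a k * (of_nat n ^ k * fact (n - k) / fact n) ^ (d - 1))"
      unfolding by_size sum_distrib_left ..
    finally show ?thesis by simp
  qed
  ultimately show ?thesis by simp
qed

end
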